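(* Let $X$ be a real Banach space, let $\Phi_n : X \to \mathbb{R}$ ($n \in \mathbb{N}$) and $\Phi : X \to \mathbb{R}$ be functionals. Suppose that: (i) $-\infty < \inf_{x\in X,\, n\in\mathbb{N}} \Phi_n(x)$; (ii) $\Phi$ and $\Phi_n$ are $C^1$-functionals for every $n\in\mathbb{N}$; (iii) if $(x_n)_{n\in\mathbb{N}} \subset X$ is such that $\sup_{n\in\mathbb{N}} |\Phi_n(x_n)| < \infty$ and $\lim_{n\to\infty} \|\partial \Phi_n(x_n)\| = 0$, then $(x_n)$ has a convergent subsequence; (iv) $\Phi_n \to \Phi$ uniformly on $X$ and $\partial\Phi_n \to \partial\Phi$ uniformly on $X$. Then there exists a point $\bar{x} \in X$ such that $$\Phi(\bar{x}) = \inf_{x\in X} \Phi(x) \quad\text{and}\quad \partial \Phi(\bar{x}) = 0.$$ Moreover, if $(\bar{x}_n)$ is a sequence such that, for every $n$, $\bar{x}_n$ is a critical point of $\Phi_n$ with $\Phi_n(\bar{x}_n) = \inf_{x\in X}\Phi_n(x)$, and $\sup_{n\in\mathbb{N}} \Phi_n(\bar{x}_n) < \infty$, then some subsequence of $(\bar{x}_n)$ converges to a critical point of $\Phi$.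
   Context: For a $C^1$-functional $\Psi: X\to\mathbb{R}$, $\partial\Psi(x) \in X^*$ denotes its (Fréchet) derivative at $x$, and $\|\partial\Psi(x)\|$ is the norm in the dual space $X^*$. A critical point of $\Psi$ is a point $x$ with $\partial\Psi(x)=0$. Uniform convergence $\Phi_n\to\Phi$ on $X$ means: for all $\varepsilon>0$ there is $N\in\mathbb{N}$ such that $|\Phi(x)-\Phi_n(x)|<\varepsilon$ for all $x\in X$ and $n\ge N$; uniform convergence of the derivatives is meant in the same way with the norm of $X^*$. *)

theory Defs
  imports "HOL-Analysis.Analysis"
begin

(* The dual space of 'a, with its operator norm, is the type 'a \<Rightarrow>\<^sub>L real. Bundling the
   derivative as an element of that type is meaningful only where \<Psi> is differentiable. *)
definition dual_deriv :: "('a::real_normed_vector \<Rightarrow> real) \<Rightarrow> 'a \<Rightarrow> ('a \<Rightarrow>\<^sub>L real)"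
  where "dual_deriv \<Psi> x = Blinfun (frechet_derivative \<Psi> (at x))"

definition C1_functional :: "('a::real_normed_vector \<Rightarrow> real) \<Rightarrow> bool"
  where "C1_functional \<Psi> \<longleftrightarrow>
    (\<forall>x. \<Psi> differentiable (at x)) \<and> continuous_on UNIV (dual_deriv \<Psi>)"

definition critical_point :: "('a::real_normed_vector \<Rightarrow> real) \<Rightarrow> 'a \<Rightarrow> bool"
  where "critical_point \<Psi> x \<longleftrightarrow> dual_deriv \<Psi> x = 0"

lemma has_derivative_dual_deriv:
  assumes "\<Psi> differentiable (at x)"
  shows "(\<Psi> has_derivative blinfun_apply (dual_deriv \<Psi> x)) (at x)"
proof -
  have *: "(\<Psi> has_derivative frechet_derivative \<Psi> (at x)) (at x)"
    using assms by (simp add: frechet_derivative_works)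
  then have "bounded_linear (frechet_derivative \<Psi> (at x))"
    by (rule has_derivative_bounded_linear)
  with * show ?thesis
    by (simp add: dual_deriv_def bounded_linear_Blinfun_apply)
qed

end

theory Submission
  imports Defs
begin

text \<open>
  A minimising sequence of \<open>\<Phi>\<close> need not converge, and the derivatives along it need
  not be small.  Ekeland's variational principle (lemma \<open>ekeland_variational_principle\<close>)
  repairs the second defect: it moves an almost minimiser to a point \<open>v\<close> that minimises
  \<open>f + \<epsilon> dist v\<close>, and at such a point the derivative has norm at most \<open>\<epsilon>\<close>
  (lemma \<open>norm_derivative_le_slope\<close>).  So \<open>\<Phi>\<close> has a minimising sequence with
  \<open>\<partial>\<Phi> (x\<^sub>k) \<rightarrow> 0\<close>.

  The compactness hypothesis concerns the functionals \<open>\<Phi>\<^sub>n\<close>, not \<open>\<Phi>\<close>; but uniform convergence makes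
  \<open>\<Phi>\<^sub>k (x\<^sub>k) - \<Phi> (x\<^sub>k)\<close> and \<open>\<partial>\<Phi>\<^sub>k (x\<^sub>k) - \<partial>\<Phi> (x\<^sub>k)\<close> tend to zero along every sequence
  (lemma \<open>uniform_limit_diagonal\<close>), so the same sequence is admissible for the \<open>\<Phi>\<^sub>n\<close> and has a
  convergent subsequence.  Continuity of \<open>\<Phi>\<close> and of \<open>\<partial>\<Phi>\<close> turns its limit into a critical
  minimiser.  The second assertion is the same transfer in the other direction: critical points of
  \<open>\<Phi>\<^sub>n\<close> with bounded values form an admissible sequence along which \<open>\<partial>\<Phi>\<close> tends to zero.
\<close>

text \<open>
  The sets \<open>S x\<close> of points that pay for their distance from \<open>x\<close> by a decrease of \<open>f\<close> are nested
  along the preorder they define.  Following almost-minimisers of \<open>f\<close> inside them, the diameters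
  shrink to zero, and the only point common to all of them cannot be improved further.
\<close>

lemma ekeland_variational_principle:
  fixes f :: "'a::complete_space \<Rightarrow> real"
  assumes cont: "continuous_on UNIV f" and bdd: "bdd_below (range f)" and "c > 0"
  obtains v where "f v + c * dist u v \<le> f u"
    and "\<And>w. w \<noteq> v \<Longrightarrow> f v < f w + c * dist v w"
proof -
  define S where "S x = {w. f w + c * dist x w \<le> f x}" for x
  have self: "x \<in> S x" for x by (simp add: S_def)
  then have S_nonempty: "S x \<noteq> {}" for x by blast
  have S_mono: "S y \<subseteq> S x" if "y \<in> S x" for x y
  proof
    fix z assume "z \<in> S y"
    have "c * dist x z \<le> c * dist x y + c * dist y z"
      using \<open>c > 0\<close> dist_triangle[of x z y] by (simp flip: distrib_left)
    with that \<open>z \<in> S y\<close> show "z \<in> S x" by (simp add: S_def)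
  qed
  have S_closed: "closed (S x)" for x
    unfolding S_def by (intro closed_Collect_le continuous_intros cont)
  have bddS: "bdd_below (f ` A)" for A
    using bdd by (rule bdd_below_mono) auto
  have "\<exists>y. True \<and> (y \<in> S x \<and> (\<forall>z\<in>S x. f y \<le> f z + inverse (real (Suc n))))" for x n
  proof -
    have "Inf (f ` S x) < Inf (f ` S x) + inverse (real (Suc n))" by simp
    then obtain y where "y \<in> S x" "f y < Inf (f ` S x) + inverse (real (Suc n))"
      using cInf_lessD[of "f ` S x"] self by blast
    moreover have "Inf (f ` S x) \<le> f z" if "z \<in> S x" for z
      using that bddS by (intro cInf_lower) auto
    ultimately show ?thesis by force
  qed
  then obtain x where x0: "x 0 = u"
    and x_step: "\<And>n. x (Suc n) \<in> S (x n)"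
    and x_min: "\<And>n z. z \<in> S (x n) \<Longrightarrow> f (x (Suc n)) \<le> f z + inverse (real (Suc n))"
    using dependent_nat_choice[where P = "\<lambda>n y. n = 0 \<longrightarrow> y = u"
        and Q = "\<lambda>n x y. y \<in> S x \<and> (\<forall>z\<in>S x. f y \<le> f z + inverse (real (Suc n)))"]
    by (metis nat.distinct(1))
  have decreasing: "S (x n) \<subseteq> S (x m)" if "m \<le> n" for m n
    using that by (rule lift_Suc_antimono_le[rotated]) (intro S_mono x_step)
  \<comment> \<open>A point of \<open>S (x (Suc n))\<close> also lies in \<open>S (x n)\<close>, where \<open>x (Suc n)\<close> is almost minimal; so it
    cannot lower \<open>f\<close> by much, and a point that gains little must stay near \<open>x (Suc n)\<close>.\<close>
  have small: "c * dist (x (Suc n)) w \<le> inverse (real (Suc n))" if "w \<in> S (x (Suc n))" for n w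
    using that x_min[of w n] decreasing[of n "Suc n"] by (auto simp: S_def)
  have "\<exists>a. \<Inter> (range (S \<circ> x)) = {a}"
  proof (rule decreasing_closed_nest_sing)
    fix \<epsilon> :: real assume "\<epsilon> > 0"
    then obtain n where n: "inverse (real (Suc n)) < c * \<epsilon> / 2"
      using \<open>c > 0\<close> reals_Archimedean[of "c * \<epsilon> / 2"] by auto
    have near: "dist (x (Suc n)) w < \<epsilon> / 2" if "w \<in> S (x (Suc n))" for w
    proof -
      have "c * dist (x (Suc n)) w < c * (\<epsilon> / 2)" using small[OF that] n by simp
      then show ?thesis using \<open>c > 0\<close> by (simp only: mult_less_cancel_left_pos)
    qed
    show "\<exists>n. \<forall>y\<in>(S \<circ> x) n. \<forall>z\<in>(S \<circ> x) n. dist y z < \<epsilon>"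
      using near dist_triangle_half_r by (metis comp_apply)
  qed (simp_all add: S_closed S_nonempty decreasing)
  then obtain v where v: "\<Inter> (range (S \<circ> x)) = {v}" ..
  then have v_in: "v \<in> S (x n)" for n by auto
  show thesis
  proof
    show "f v + c * dist u v \<le> f u" using v_in[of 0] by (simp add: S_def x0)
    fix w assume "w \<noteq> v"
    then obtain n where "w \<notin> S (x n)" using v by auto
    then have "w \<notin> S v" using S_mono[OF v_in] by auto
    then show "f v < f w + c * dist v w" by (simp add: S_def)
  qed
qed

text \<open>
  The hypothesis bounds the one-sided difference quotients of \<open>f\<close> at \<open>v\<close> in unit directions from below
  by \<open>- c\<close>; since \<open>D\<close> is odd, a lower bound in all directions is a bound for the norm.
\<close>

lemma norm_derivative_le_slope:
  fixes f :: "'a::real_normed_vector \<Rightarrow> real" and D :: "'a \<Rightarrow>\<^sub>L real"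
  assumes deriv: "(f has_derivative blinfun_apply D) (at v)" and "c \<ge> 0"
    and slope: "\<And>w. f v \<le> f w + c * dist v w"
  shows "norm D \<le> c"
proof -
  have lower: "- (c * norm h) \<le> D h" for h
  proof (rule ccontr)
    assume "\<not> ?thesis"
    then have neg: "D h + c * norm h < 0" by simp
    \<comment> \<open>For \<open>t > 0\<close> this is \<open>f + c dist v\<close> on the ray from \<open>v\<close> in direction \<open>h\<close>; unlike the norm,
      the term linear in \<open>t\<close> is differentiable at 0.\<close>
    define g where "g t = f (v + t *\<^sub>R h) + c * norm h * t" for t
    have "((\<lambda>t. f (v + t *\<^sub>R h)) has_derivative (\<lambda>t. D (t *\<^sub>R h))) (at 0)"
      by (rule has_derivative_compose[where g = f]) (use deriv in \<open>auto intro!: derivative_eq_intros\<close>)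
    then have "((\<lambda>t. f (v + t *\<^sub>R h)) has_real_derivative D h) (at 0)"
      by (simp add: has_field_derivative_def blinfun.scaleR_right mult_commute_abs)
    then have "(g has_real_derivative D h + c * norm h) (at 0)"
      unfolding g_def by (auto intro!: derivative_eq_intros)
    from DERIV_neg_dec_right[OF this neg] obtain d where "d > 0" "g 0 > g (d / 2)" by force
    then show False
      using slope[of "v + (d / 2) *\<^sub>R h"] by (simp add: g_def dist_norm algebra_simps)
  qed
  have "\<bar>D h\<bar> \<le> c * norm h" for h
    using lower[of h] lower[of "- h"] by (simp add: blinfun.minus_right abs_le_iff)
  with \<open>c \<ge> 0\<close> show ?thesis by (intro norm_blinfun_bound) auto
qed

text \<open>
  A \<open>u\<close> with \<open>f u\<close> close to the infimum is the start for Ekeland's principle with slope \<open>\<epsilon>\<close>; the point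
  reached has no larger value, and the slope bounds its derivative.
\<close>

lemma almost_critical_almost_minimiser:
  fixes f :: "'a::banach \<Rightarrow> real"
  assumes diff: "\<And>x. f differentiable (at x)" and bdd: "bdd_below (range f)" and "\<epsilon> > 0"
  obtains v where "f v < Inf (range f) + \<epsilon>" and "norm (dual_deriv f v) \<le> \<epsilon>"
proof -
  have "Inf (range f) < Inf (range f) + \<epsilon>" using \<open>\<epsilon> > 0\<close> by simp
  then obtain u where u: "f u < Inf (range f) + \<epsilon>"
    using cInf_lessD[of "range f"] by blast
  have cont: "continuous_on UNIV f"
    by (simp add: continuous_at_imp_continuous_on differentiable_imp_continuous_within diff)
  obtain v where v: "f v + \<epsilon> * dist u v \<le> f u"
    and vmin: "\<And>w. w \<noteq> v \<Longrightarrow> f v < f w + \<epsilon> * dist v w"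
    using ekeland_variational_principle[OF cont bdd \<open>\<epsilon> > 0\<close>] by blast
  show thesis
  proof
    have "0 \<le> \<epsilon> * dist u v" using \<open>\<epsilon> > 0\<close> by simp
    with u v show "f v < Inf (range f) + \<epsilon>" by linarith
    have "f v \<le> f w + \<epsilon> * dist v w" for w
      using vmin[of w] by (cases "w = v") auto
    then show "norm (dual_deriv f v) \<le> \<epsilon>"
      using norm_derivative_le_slope[OF has_derivative_dual_deriv[OF diff]] \<open>\<epsilon> > 0\<close> by simp
  qed
qed

text \<open>
  Pointwise convergence would not suffice here, since the point \<open>x n\<close> moves with the index.
\<close>

lemma uniform_limit_diagonal:
  fixes F :: "nat \<Rightarrow> 'a \<Rightarrow> 'b::real_normed_vector"
  assumes "uniform_limit UNIV F G sequentially"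
  shows "(\<lambda>n. F n (x n) - G (x n)) \<longlonglongrightarrow> 0"
proof (rule tendstoI)
  fix e :: real assume "e > 0"
  from uniform_limitD[OF assms this]
  show "\<forall>\<^sub>F n in sequentially. dist (F n (x n) - G (x n)) 0 < e"
    by (rule eventually_mono) (simp add: dist_norm)
qed

lemma SUP_ereal_abs_less_top:
  assumes "\<And>n. \<bar>a n\<bar> \<le> (b::real)"
  shows "(SUP n. ereal \<bar>a n\<bar>) < \<infinity>"
proof -
  have "(SUP n. ereal \<bar>a n\<bar>) \<le> ereal b" using assms by (intro SUP_least) simp
  then show ?thesis by (rule le_less_trans) simp
qed

theorem theorem2:
  fixes \<Phi> :: "'a::banach \<Rightarrow> real" and \<Phi>n :: "nat \<Rightarrow> 'a \<Rightarrow> real"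
  assumes bounded_below: "- \<infinity> < (INF (x, n)\<in>UNIV. ereal (\<Phi>n n x))"
    and C1: "C1_functional \<Phi>" "\<And>n. C1_functional (\<Phi>n n)"
    and compactness: "\<And>x. (SUP n. ereal \<bar>\<Phi>n n (x n)\<bar>) < \<infinity> \<Longrightarrow>
        (\<lambda>n. norm (dual_deriv (\<Phi>n n) (x n))) \<longlonglongrightarrow> 0 \<Longrightarrow>
        \<exists>r l. strict_mono (r :: nat \<Rightarrow> nat) \<and> (x \<circ> r) \<longlonglongrightarrow> l"
    and uniform: "uniform_limit UNIV \<Phi>n \<Phi> sequentially"
    and uniform_deriv:
      "uniform_limit UNIV (\<lambda>n. dual_deriv (\<Phi>n n)) (dual_deriv \<Phi>) sequentially"
  shows "(\<exists>xbar. ereal (\<Phi> xbar) = (INF x. ereal (\<Phi> x)) \<and> dual_deriv \<Phi> xbar = 0) \<and>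
    (\<forall>xs. (\<forall>n. critical_point (\<Phi>n n) (xs n) \<and>
              ereal (\<Phi>n n (xs n)) = (INF x. ereal (\<Phi>n n x))) \<and>
          (SUP n. ereal (\<Phi>n n (xs n))) < \<infinity> \<longrightarrow>
          (\<exists>r l. strict_mono (r :: nat \<Rightarrow> nat) \<and> (xs \<circ> r) \<longlonglongrightarrow> l \<and> critical_point \<Phi> l))"
proof -
  obtain m where m: "\<And>n x. m \<le> \<Phi>n n x"
  proof -
    obtain m where "ereal m < (INF (x, n)\<in>UNIV. ereal (\<Phi>n n x))"
      using bounded_below ereal_dense2 by blast
    also have "(INF (x, n)\<in>UNIV. ereal (\<Phi>n n x)) \<le> ereal (\<Phi>n n x)" for n x
      using INF_lower[of "(x, n)" UNIV "\<lambda>(x, n). ereal (\<Phi>n n x)"] by simp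
    finally have "m < \<Phi>n n x" for n x by simp
    then show thesis using that less_imp_le by blast
  qed
  have diff: "\<Phi> differentiable (at x)" and deriv_cont: "isCont (dual_deriv \<Phi>) x" for x
    using C1(1) by (auto simp: C1_functional_def continuous_on_eq_continuous_at)
  have cont: "isCont \<Phi> x" for x
    by (simp add: differentiable_imp_continuous_within diff)
  have deriv_diff: "(\<lambda>n. dual_deriv (\<Phi>n n) (x n) - dual_deriv \<Phi> (x n)) \<longlonglongrightarrow> 0" for x
    by (rule uniform_limit_diagonal[OF uniform_deriv])
  have bdd: "bdd_below (range \<Phi>)"
  proof (rule bdd_belowI2)
    fix x
    show "m \<le> \<Phi> x"
      using tendsto_uniform_limitI[OF uniform, of x] m by (intro LIMSEQ_le_const) auto
  qed

  have minimiser: "\<exists>l. \<Phi> l = Inf (range \<Phi>) \<and> dual_deriv \<Phi> l = 0"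
  proof -
    have "\<exists>v. \<Phi> v < Inf (range \<Phi>) + inverse (real (Suc n)) \<and>
        norm (dual_deriv \<Phi> v) \<le> inverse (real (Suc n))" for n
      using almost_critical_almost_minimiser[OF diff bdd, of "inverse (real (Suc n))"] by auto
    then obtain x where x: "\<And>n. \<Phi> (x n) < Inf (range \<Phi>) + inverse (real (Suc n))"
      and x': "\<And>n. norm (dual_deriv \<Phi> (x n)) \<le> inverse (real (Suc n))"
      by metis
    have val: "(\<lambda>n. \<Phi> (x n)) \<longlonglongrightarrow> Inf (range \<Phi>)"
    proof (rule tendsto_sandwich[OF _ _ tendsto_const])
      show "(\<lambda>n. Inf (range \<Phi>) + inverse (real (Suc n))) \<longlonglongrightarrow> Inf (range \<Phi>)"
        by (rule LIMSEQ_inverse_real_of_nat_add)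
    qed (use x less_imp_le in \<open>auto intro!: always_eventually cInf_lower bdd simp del: of_nat_Suc\<close>)
    have der: "(\<lambda>n. dual_deriv \<Phi> (x n)) \<longlonglongrightarrow> 0"
      by (rule Lim_null_comparison[OF _ LIMSEQ_inverse_real_of_nat]) (simp add: x' del: of_nat_Suc)
    have "(\<lambda>n. \<Phi>n n (x n)) \<longlonglongrightarrow> Inf (range \<Phi>)"
      using tendsto_add[OF uniform_limit_diagonal[OF uniform, of x] val] by simp
    then have "Bseq (\<lambda>n. \<Phi>n n (x n))" by (intro convergent_imp_Bseq convergentI)
    then obtain b where "\<And>n. \<bar>\<Phi>n n (x n)\<bar> \<le> b" unfolding Bseq_def by auto
    then have "(SUP n. ereal \<bar>\<Phi>n n (x n)\<bar>) < \<infinity>" by (rule SUP_ereal_abs_less_top)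
    moreover have "(\<lambda>n. norm (dual_deriv (\<Phi>n n) (x n))) \<longlonglongrightarrow> 0"
      using tendsto_add[OF deriv_diff[of x] der] by (intro tendsto_norm_zero) simp
    ultimately obtain r l where r: "strict_mono (r :: nat \<Rightarrow> nat)" and l: "(x \<circ> r) \<longlonglongrightarrow> l"
      using compactness by blast
    have "(\<lambda>n. \<Phi> ((x \<circ> r) n)) \<longlonglongrightarrow> \<Phi> l" by (rule isCont_tendsto_compose[OF cont l])
    moreover have "(\<lambda>n. \<Phi> ((x \<circ> r) n)) \<longlonglongrightarrow> Inf (range \<Phi>)"
      using LIMSEQ_subseq_LIMSEQ[OF val r] by (simp add: o_def)
    moreover have "(\<lambda>n. dual_deriv \<Phi> ((x \<circ> r) n)) \<longlonglongrightarrow> dual_deriv \<Phi> l"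
      by (rule isCont_tendsto_compose[OF deriv_cont l])
    moreover have "(\<lambda>n. dual_deriv \<Phi> ((x \<circ> r) n)) \<longlonglongrightarrow> 0"
      using LIMSEQ_subseq_LIMSEQ[OF der r] by (simp add: o_def)
    ultimately show ?thesis by (blast intro: LIMSEQ_unique)
  qed

  have limit_critical: "\<exists>r l. strict_mono (r :: nat \<Rightarrow> nat) \<and> (xs \<circ> r) \<longlonglongrightarrow> l \<and> critical_point \<Phi> l"
    if crit: "\<And>n. critical_point (\<Phi>n n) (xs n)" and fin: "(SUP n. ereal (\<Phi>n n (xs n))) < \<infinity>" for xs
  proof -
    obtain M where "(SUP n. ereal (\<Phi>n n (xs n))) < ereal M"
      using fin ereal_dense2 by blast
    then have M: "\<Phi>n n (xs n) \<le> M" for n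
      using SUP_upper[of n UNIV "\<lambda>n. ereal (\<Phi>n n (xs n))"] by (simp flip: ereal_less_eq(3))
    have zero: "dual_deriv (\<Phi>n n) (xs n) = 0" for n
      using crit by (simp add: critical_point_def)
    have "\<bar>\<Phi>n n (xs n)\<bar> \<le> \<bar>m\<bar> + \<bar>M\<bar>" for n
      using m[of n "xs n"] M[of n] by linarith
    then have "(SUP n. ereal \<bar>\<Phi>n n (xs n)\<bar>) < \<infinity>" by (rule SUP_ereal_abs_less_top)
    then obtain r l where r: "strict_mono (r :: nat \<Rightarrow> nat)" and l: "(xs \<circ> r) \<longlonglongrightarrow> l"
      using compactness[of xs] zero by auto
    have "(\<lambda>n. dual_deriv \<Phi> (xs n)) \<longlonglongrightarrow> 0"
      using tendsto_minus[OF deriv_diff[of xs]] by (simp add: zero)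
    from LIMSEQ_subseq_LIMSEQ[OF this r] have "(\<lambda>n. dual_deriv \<Phi> ((xs \<circ> r) n)) \<longlonglongrightarrow> 0"
      by (simp add: o_def)
    moreover have "(\<lambda>n. dual_deriv \<Phi> ((xs \<circ> r) n)) \<longlonglongrightarrow> dual_deriv \<Phi> l"
      by (rule isCont_tendsto_compose[OF deriv_cont l])
    ultimately have "critical_point \<Phi> l"
      unfolding critical_point_def by (blast intro: LIMSEQ_unique)
    with r l show ?thesis by blast
  qed

  obtain xbar where xbar: "\<Phi> xbar = Inf (range \<Phi>)" "dual_deriv \<Phi> xbar = 0"
    using minimiser by blast
  have "\<Phi> xbar \<le> \<Phi> x" for x
    unfolding xbar(1) by (intro cInf_lower rangeI bdd)
  then have "ereal (\<Phi> xbar) = (INF x. ereal (\<Phi> x))"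
    by (intro antisym INF_greatest INF_lower) auto
  with xbar(2) limit_critical show ?thesis by blast
qed

end
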